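(* Let $K$ be a compact subset of $\mathbb{R}^d$. A typical measure $\mu\in\mathcal{P}(K)$ satisfies: for every $x\in K$, $\overline{\dim}_{\rm loc}(\mu;x)\geq\overline{\dim}_{B,{\rm loc}}(K)$.
   Context: $\mathcal{P}(K)$ is the set of Borel probability measures on $K$, endowed with the weak topology (which is completely metrizable). A property is true for a typical measure of $\mathcal{P}(K)$ if it is satisfied by all elements of a dense $G_\delta$ subset of $\mathcal{P}(K)$. For $\mu\in\mathcal{P}(K)$ and $x\in K$, with $B(x,r)$ the ball of center $x$ and radius $r$, the upper local dimension is $\overline{\dim}_{\rm loc}(\mu;x)=\limsup_{r\to 0}\frac{\log\mu(B(x,r))}{\log r}$ (with $\log 0=-\infty$, so it is $+\infty$ off the support of $\mu$). For a set $E\subset\mathbb{R}^d$, $\overline{\dim}_B(E)$ denotes its upper box dimension. The local upper box dimension of $K$ is $\overline{\dim}_{B,{\rm loc}}(K)=\inf_{x\in K,\ \rho>0}\overline{\dim}_B\big(K\cap B(x,\rho)\big)$. *)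

theory Defs
  imports "HOL-Probability.Probability"
begin

definition log_ennreal :: "ennreal \<Rightarrow> ereal" where
  "log_ennreal x =
     (if x = 0 then -\<infinity> else if x = \<infinity> then \<infinity> else ereal (ln (enn2real x)))"

(* The elements live on the subspace K (space \<mu> = K), not on the whole ambient space. *)
definition borel_prob_measures :: "'a::topological_space set \<Rightarrow> 'a measure set" where
  "borel_prob_measures K = {\<mu>. prob_space \<mu> \<and> sets \<mu> = sets (restrict_space borel K)}"

(* The coarsest topology making all the maps \<mu> \<mapsto> \<integral> f d\<mu>, f bounded and continuous
   on K, continuous. *)
definition weak_topology :: "'a::topological_space set \<Rightarrow> 'a measure topology" where
  "weak_topology K = topology_generated_by
     {{\<mu> \<in> borel_prob_measures K. (\<integral>x. f x \<partial>\<mu>) \<in> U} | (f :: 'a \<Rightarrow> real) U.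
        continuous_on K f \<and> bounded (f ` K) \<and> open U}"

lemma topspace_weak_topology: "topspace (weak_topology K) = borel_prob_measures K"
proof
  show "topspace (weak_topology K) \<subseteq> borel_prob_measures K"
    unfolding weak_topology_def by auto
  have "borel_prob_measures K \<in>
     {{\<mu> \<in> borel_prob_measures K. (\<integral>x. f x \<partial>\<mu>) \<in> U} | (f :: 'a \<Rightarrow> real) U.
        continuous_on K f \<and> bounded (f ` K) \<and> open U}"
    by (rule CollectI, rule exI[of _ "\<lambda>_. 0"], rule exI[of _ UNIV]) (auto intro: bounded_subset[of "{0}"])
  then show "borel_prob_measures K \<subseteq> topspace (weak_topology K)"
    unfolding weak_topology_def topology_generated_by_topspace by (rule Union_upper)
qed

definition typical :: "'b topology \<Rightarrow> ('b \<Rightarrow> bool) \<Rightarrow> bool" where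
  "typical X P \<longleftrightarrow>
     (\<exists>G. gdelta_in X G \<and> X closure_of G = topspace X \<and> (\<forall>y\<in>G. P y))"

definition upper_local_dim :: "'a::metric_space measure \<Rightarrow> 'a \<Rightarrow> ereal" where
  "upper_local_dim \<mu> x =
     Limsup (at_right 0)
       (\<lambda>r::real. log_ennreal (emeasure \<mu> (space \<mu> \<inter> ball x r)) / ereal (ln r))"

(* Least number of balls of radius r needed to cover E; infinite if there is no finite cover. *)
definition covering_number :: "'a::metric_space set \<Rightarrow> real \<Rightarrow> ennreal" where
  "covering_number E r =
     (INF C \<in> {C. finite C \<and> E \<subseteq> (\<Union>c\<in>C. ball c r)}. of_nat (card C))"

definition upper_box_dim :: "'a::metric_space set \<Rightarrow> ereal" where
  "upper_box_dim E =
     Limsup (at_right 0) (\<lambda>r::real. log_ennreal (covering_number E r) / ereal (- ln r))"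

definition local_upper_box_dim :: "'a::metric_space set \<Rightarrow> ereal" where
  "local_upper_box_dim K = (INF x\<in>K. INF \<rho>\<in>{0::real<..}. upper_box_dim (K \<inter> ball x \<rho>))"

end

(* The typical set is the intersection, over rational s below the local upper box dimension and
   over n, of the weakly open sets of measures that give every point of K some ball of radius
   r < 1/(n+1) and mass less than r^s. To see that it is dense without using completeness of the
   weak topology, realise a given measure mu as the law of the first projection on the product of
   mu with an auxiliary atomless space. The K-valued random variables on this space form a
   complete metric space under the supremum distance, and the law depends continuously on the
   random variable, so the Baire category theorem can be applied to random variables instead of
   measures. It remains to perturb a random variable uniformly little into one whose law lies in
   the given open set. *)

theory Submission
  imports Defs
begin

section \<open>Reading the two dimensions at single scales\<close>

lemma log_ennreal_le:
  assumes "x \<le> ennreal (r powr s)" "0 < r"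
  shows "log_ennreal x \<le> ereal (s * ln r)"
proof (cases "x = 0")
  case True
  then show ?thesis by (simp add: log_ennreal_def)
next
  case False
  have "x < \<infinity>" using assms(1) by (simp add: order.strict_trans1)
  then obtain c where c: "x = ennreal c" "0 \<le> c" by (cases x) auto
  with False have "0 < c" by (cases "c = 0") auto
  moreover have "c \<le> r powr s" using assms c by simp
  ultimately have "ln c \<le> s * ln r"
    using assms(2) by (metis ln_mono ln_powr order_less_imp_not_eq2 powr_gt_zero)
  then show ?thesis using c \<open>0 < c\<close> by (simp add: log_ennreal_def)
qed

text \<open>A separated set of maximal cardinality is also the set of centres of a cover.\<close>

lemma upper_box_dim_gt_separated:
  fixes E :: "'a::metric_space set"
  assumes gt: "upper_box_dim E > ereal s" and "0 < e"
  obtains R S where "0 < R" "R < e" "finite S" "S \<subseteq> E" "pairwise (\<lambda>x y. R \<le> dist x y) S"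
    "R powr - s < real (card S)"
proof (rule ccontr)
  assume contra: "\<not> thesis"
  note witness = that
  \<comment> \<open>Denying the conclusion bounds the size of every separated set at each scale
    below \<open>e\<close>. The bound serves twice: it makes a separated set of maximal size exist,
    and it then limits the covering number.\<close>
  have le: "real (card S) \<le> R powr - s"
    if "0 < R" "R < e" "finite S" "S \<subseteq> E" "pairwise (\<lambda>x y. R \<le> dist x y) S" for R S
    using witness[OF that] contra by (meson not_le)
  \<comment> \<open>Below scale 1 the denominator \<open>- ln r\<close> is positive, hence the
    \<open>min e 1\<close>.\<close>
  have quot: "log_ennreal (covering_number E r) / ereal (- ln r) \<le> ereal s"
    if r: "0 < r" "r < min e 1" for r
  proof -
    let ?P = "\<lambda>S. finite S \<and> S \<subseteq> E \<and> pairwise (\<lambda>x y. r \<le> dist x y) S"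
    obtain b :: nat where b: "r powr - s < real b" using reals_Archimedean2 by blast
    have "\<exists>S. ?P S \<and> (\<forall>T. ?P T \<longrightarrow> card T \<le> card S)"
    proof (rule ex_has_greatest_nat)
      show "?P {}" by simp
      show "\<forall>T. ?P T \<longrightarrow> card T < b"
      proof (intro allI impI)
        fix T assume "?P T"
        then have "real (card T) \<le> r powr - s" using le[of r T] r by simp
        with b show "card T < b" by linarith
      qed
    qed
    then obtain S where S: "?P S" and max: "\<And>T. ?P T \<Longrightarrow> card T \<le> card S" by blast
    have "E \<subseteq> (\<Union>c\<in>S. ball c r)"
    proof
      fix x assume "x \<in> E"
      show "x \<in> (\<Union>c\<in>S. ball c r)"
      proof (rule ccontr)
        assume x: "x \<notin> (\<Union>c\<in>S. ball c r)"
        then have far: "r \<le> dist c x" if "c \<in> S" for c using that by (simp add: not_less)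
        then have "x \<notin> S" using r by fastforce
        have "?P (insert x S)"
          using S \<open>x \<in> E\<close> far by (auto simp: pairwise_insert dist_commute)
        then have "card (insert x S) \<le> card S" by (rule max)
        then show False using \<open>x \<notin> S\<close> S by simp
      qed
    qed
    then have "covering_number E r \<le> of_nat (card S)"
      unfolding covering_number_def using S by (intro INF_lower) auto
    also have "\<dots> = ennreal (real (card S))" by (simp add: ennreal_of_nat_eq_real_of_nat)
    also have "\<dots> \<le> ennreal (r powr - s)" using le[of r S] S r by (simp add: ennreal_leI)
    finally have "log_ennreal (covering_number E r) \<le> ereal (- s * ln r)"
      using r by (intro log_ennreal_le)
    then show ?thesis using r by (subst ereal_divide_le_pos) (auto simp: mult.commute)
  qed
  have "eventually (\<lambda>r. log_ennreal (covering_number E r) / ereal (- ln r) \<le> ereal s) (at_right 0)"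
    unfolding eventually_at_right_field using quot \<open>0 < e\<close> by (intro exI[of _ "min e 1"]) auto
  then have "upper_box_dim E \<le> ereal s"
    unfolding upper_box_dim_def by (rule Limsup_bounded)
  with gt show False by simp
qed

text \<open>A limsup is bounded below by what happens at arbitrarily small radii, so one good radius
  below each 1/(n+1) is enough. This countable form of the condition is what leads to a G-delta set.
  Since \<open>ln r\<close> is negative, dividing by it turns an upper bound on the mass into a
  lower bound on the quotient.\<close>

lemma upper_local_dim_ge:
  assumes "\<And>n::nat. \<exists>r. 0 < r \<and> r < 1 / (real n + 1) \<and>
    emeasure \<mu> (space \<mu> \<inter> ball x r) \<le> ennreal (r powr s)"
  shows "ereal s \<le> upper_local_dim \<mu> x"
proof (rule ccontr)
  assume "\<not> ereal s \<le> upper_local_dim \<mu> x"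
  then have "upper_local_dim \<mu> x < ereal s" by simp
  then have "eventually (\<lambda>r. log_ennreal (emeasure \<mu> (space \<mu> \<inter> ball x r)) / ereal (ln r)
      < ereal s) (at_right 0)"
    unfolding upper_local_dim_def by (rule Limsup_lessD)
  then obtain b where b: "0 < b" "\<And>r. 0 < r \<Longrightarrow> r < b \<Longrightarrow>
      log_ennreal (emeasure \<mu> (space \<mu> \<inter> ball x r)) / ereal (ln r) < ereal s"
    unfolding eventually_at_right_field by blast
  obtain n :: nat where "inverse (real (Suc n)) < b" using reals_Archimedean[OF b(1)] by blast
  then have n: "1 / (real n + 1) < b" by (simp add: inverse_eq_divide add.commute)
  obtain r where r: "0 < r" "r < 1 / (real n + 1)"
    "emeasure \<mu> (space \<mu> \<inter> ball x r) \<le> ennreal (r powr s)" using assms[of n] by blast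
  have "1 / (real n + 1) \<le> 1" by simp
  then have "r < 1" using r by linarith
  have "log_ennreal (emeasure \<mu> (space \<mu> \<inter> ball x r)) \<le> ereal (s * ln r)"
    using r by (intro log_ennreal_le)
  then have "ereal s \<le> log_ennreal (emeasure \<mu> (space \<mu> \<inter> ball x r)) / ereal (ln r)"
    using r \<open>r < 1\<close> by (subst ereal_le_divide_neg) (auto simp: mult.commute)
  moreover have "r < b" using r(2) n by (simp add: add.commute)
  ultimately show False using b(2)[OF r(1)] by (meson not_less)
qed

section \<open>Weakly open conditions that force small balls\<close>

text \<open>A continuous substitute for the indicator of a ball, as the weak topology only sees
  integrals of continuous functions. The plateau reaches to 2r, not r, so that the bump at
  \<open>x\<close> also dominates the ball of radius r around every point of
  \<open>ball x r\<close>.\<close>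

definition bump :: "'a::metric_space \<Rightarrow> real \<Rightarrow> 'a \<Rightarrow> real" where
  "bump x r z = max 0 (min 1 (3 - dist x z / r))"

lemma continuous_on_bump [continuous_intros]: "continuous_on A (bump x r)"
  unfolding bump_def divide_inverse by (intro continuous_intros)

lemma bump_bounds: "0 \<le> bump x r z" "bump x r z \<le> 1"
  by (auto simp: bump_def)

lemma bump_eq_1: "0 < r \<Longrightarrow> dist x z \<le> 2 * r \<Longrightarrow> bump x r z = 1"
  by (simp add: bump_def field_simps)

lemma bump_eq_0: "0 < r \<Longrightarrow> 3 * r \<le> dist x z \<Longrightarrow> bump x r z = 0"
  by (simp add: bump_def field_simps)

definition bump_lt :: "'a::metric_space set \<Rightarrow> real \<Rightarrow> 'a \<times> real \<Rightarrow> 'a measure set" where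
  "bump_lt K s p = {\<mu> \<in> borel_prob_measures K. (\<integral>z. bump (fst p) (snd p) z \<partial>\<mu>) < snd p powr s}"

lemma openin_bump_lt: "openin (weak_topology K) (bump_lt K s p)"
proof -
  have "bounded (bump (fst p) (snd p) ` K)"
    by (intro boundedI[of _ 1]) (auto simp: bump_bounds)
  then have "bump_lt K s p \<in> {{\<mu> \<in> borel_prob_measures K. (\<integral>x. f x \<partial>\<mu>) \<in> U} | (f :: 'a \<Rightarrow> real) U.
        continuous_on K f \<and> bounded (f ` K) \<and> open U}"
    by (intro CollectI exI[of _ "bump (fst p) (snd p)"] exI[of _ "{..< snd p powr s}"])
       (auto simp: bump_lt_def continuous_on_bump)
  then show ?thesis
    unfolding weak_topology_def by (rule topology_generated_by_Basis)
qed

text \<open>Asking for a finite cover by bump conditions, rather than for a small ball around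
  every point, makes this set visibly open in the weak topology.\<close>

definition small_balls :: "'a::metric_space set \<Rightarrow> real \<Rightarrow> nat \<Rightarrow> 'a measure set" where
  "small_balls K s n =
    (\<Union>F \<in> {F. finite F \<and> F \<subseteq> K \<times> {0 <..< 1 / (real n + 1)} \<and> K \<subseteq> (\<Union>(x, r)\<in>F. ball x r)}.
       borel_prob_measures K \<inter> (\<Inter>p\<in>F. bump_lt K s p))"

lemma openin_small_balls: "openin (weak_topology K) (small_balls K s n)"
proof -
  have "openin (weak_topology K) (borel_prob_measures K \<inter> (\<Inter>p\<in>F. bump_lt K s p))"
    if "finite F" for F
    unfolding topspace_weak_topology[symmetric]
    using that by (auto intro!: openin_Int_Inter openin_bump_lt)
  then show ?thesis unfolding small_balls_def by (intro openin_Union) auto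
qed

lemma borel_prob_measuresD:
  assumes "\<mu> \<in> borel_prob_measures K"
  shows "prob_space \<mu>" "space \<mu> = K" "sets \<mu> = sets (restrict_space borel K)"
  using assms sets_eq_imp_space_eq[of \<mu> "restrict_space borel K"]
  by (auto simp: borel_prob_measures_def space_restrict_space)

lemma ball_in_sets:
  assumes "\<mu> \<in> borel_prob_measures K"
  shows "K \<inter> ball x r \<in> sets \<mu>"
  unfolding borel_prob_measuresD(3)[OF assms] sets_restrict_space by auto

lemma integrable_bump:
  assumes "\<mu> \<in> borel_prob_measures K"
  shows "integrable \<mu> (bump x r)"
proof -
  interpret prob_space \<mu> using borel_prob_measuresD[OF assms] by simp
  have "bump x r \<in> borel_measurable (restrict_space borel K)"
    by (intro borel_measurable_continuous_on_restrict continuous_on_bump)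
  then have "bump x r \<in> borel_measurable \<mu>"
    using measurable_cong_sets[OF borel_prob_measuresD(3)[OF assms] refl] by blast
  then show ?thesis
    by (intro integrable_const_bound[of _ 1]) (auto simp: bump_bounds)
qed

text \<open>The point \<open>x\<close> lies in some \<open>ball y r\<close> of the cover. By the
  triangle inequality \<open>ball x r\<close> stays within 2r of \<open>y\<close>, where the bump
  equals 1, so its mass is at most the integral of the bump.\<close>

lemma small_ballsD:
  assumes "\<mu> \<in> small_balls K s n" "x \<in> K"
  shows "\<exists>r. 0 < r \<and> r < 1 / (real n + 1) \<and> emeasure \<mu> (space \<mu> \<inter> ball x r) \<le> ennreal (r powr s)"
proof -
  obtain F where F: "F \<subseteq> K \<times> {0 <..< 1 / (real n + 1)}" "K \<subseteq> (\<Union>(x, r)\<in>F. ball x r)"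
    and \<mu>: "\<mu> \<in> borel_prob_measures K" "\<And>p. p \<in> F \<Longrightarrow> \<mu> \<in> bump_lt K s p"
    using assms(1) unfolding small_balls_def by auto
  obtain y r where yr: "(y, r) \<in> F" "x \<in> ball y r" using F(2) assms(2) by auto
  then have r: "0 < r" "r < 1 / (real n + 1)" using F by auto
  interpret prob_space \<mu> using borel_prob_measuresD[OF \<mu>(1)] by simp
  have "prob (K \<inter> ball x r) = (\<integral>z. indicator (K \<inter> ball x r) z \<partial>\<mu>)"
    using ball_in_sets[OF \<mu>(1)]
    by (subst Bochner_Integration.integral_indicator)
       (auto intro!: arg_cong[where f=prob] simp: borel_prob_measuresD[OF \<mu>(1)])
  also have "\<dots> \<le> (\<integral>z. bump y r z \<partial>\<mu>)"
  proof (rule integral_mono)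
    show "integrable \<mu> (indicator (K \<inter> ball x r) :: _ \<Rightarrow> real)"
      using ball_in_sets[OF \<mu>(1)] by (intro integrable_real_indicator) (auto simp: emeasure_eq_measure)
    show "integrable \<mu> (bump y r)" by (rule integrable_bump[OF \<mu>(1)])
    fix z
    have "dist y z \<le> 2 * r" if "z \<in> ball x r"
      using that yr dist_triangle[of y z x] by (simp add: dist_commute)
    then show "indicator (K \<inter> ball x r) z \<le> bump y r z"
      using bump_eq_1[OF r(1), of y z] bump_bounds by (auto simp: indicator_def)
  qed
  also have "\<dots> \<le> r powr s" using \<mu>(2)[OF yr(1)] by (simp add: bump_lt_def)
  finally show ?thesis
    using r by (intro exI[of _ r])
      (auto simp: emeasure_eq_measure borel_prob_measuresD[OF \<mu>(1)] intro: ennreal_leI)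
qed

text \<open>The bump vanishes from distance 3r on, so the mass of the ball of radius 3r bounds its
  integral; compactness reduces the chosen balls to finitely many.\<close>

lemma small_ballsI:
  assumes "compact K" and \<mu>: "\<mu> \<in> borel_prob_measures K"
    and small: "\<And>x. x \<in> K \<Longrightarrow>
      \<exists>r. 0 < r \<and> r < 1 / (real n + 1) \<and> measure \<mu> (K \<inter> ball x (3 * r)) < r powr s"
  shows "\<mu> \<in> small_balls K s n"
proof -
  interpret prob_space \<mu> using borel_prob_measuresD[OF \<mu>] by simp
  obtain \<rho> where \<rho>: "\<And>x. x \<in> K \<Longrightarrow>
      0 < \<rho> x \<and> \<rho> x < 1 / (real n + 1) \<and> prob (K \<inter> ball x (3 * \<rho> x)) < \<rho> x powr s"
    using small by metis
  have "K \<subseteq> (\<Union>x\<in>K. ball x (\<rho> x))" using \<rho> by force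
  then obtain C where C: "C \<subseteq> K" "finite C" "K \<subseteq> (\<Union>x\<in>C. ball x (\<rho> x))"
    using compactE_image[OF assms(1), of K "\<lambda>x. ball x (\<rho> x)"] by auto
  have "\<mu> \<in> bump_lt K s (x, \<rho> x)" if "x \<in> C" for x
  proof -
    have x: "x \<in> K" using that C by auto
    have "(\<integral>z. bump x (\<rho> x) z \<partial>\<mu>) \<le> (\<integral>z. indicator (K \<inter> ball x (3 * \<rho> x)) z \<partial>\<mu>)"
    proof (rule integral_mono)
      show "integrable \<mu> (indicator (K \<inter> ball x (3 * \<rho> x)) :: _ \<Rightarrow> real)"
        using ball_in_sets[OF \<mu>] by (intro integrable_real_indicator) (auto simp: emeasure_eq_measure)
      show "integrable \<mu> (bump x (\<rho> x))" by (rule integrable_bump[OF \<mu>])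
      fix z assume "z \<in> space \<mu>"
      then show "bump x (\<rho> x) z \<le> indicator (K \<inter> ball x (3 * \<rho> x)) z"
        using bump_eq_0[of "\<rho> x" x z] \<rho>[OF x] bump_bounds borel_prob_measuresD[OF \<mu>]
        by (auto simp: indicator_def)
    qed
    also have "\<dots> = prob (K \<inter> ball x (3 * \<rho> x))"
      using ball_in_sets[OF \<mu>]
      by (subst Bochner_Integration.integral_indicator)
         (auto intro!: arg_cong[where f=prob] simp: borel_prob_measuresD[OF \<mu>])
    finally show ?thesis using \<rho>[OF x] \<mu> by (simp add: bump_lt_def)
  qed
  then show ?thesis unfolding small_balls_def
    using C \<rho> \<mu> by (intro UN_I[of "(\<lambda>x. (x, \<rho> x)) ` C"]) (auto simp: subset_iff)
qed

section \<open>Random variables with the supremum distance, and Baire category\<close>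

text \<open>Values in \<open>K\<close> are required on the whole type, also off
  \<open>space M\<close>, because the supremum distance of \<open>Met_TC.fdist UNIV\<close> is taken
  over the whole type.\<close>

definition rvs :: "'w measure \<Rightarrow> 'a::metric_space set \<Rightarrow> ('w \<Rightarrow> 'a) set" where
  "rvs M K = {X \<in> borel_measurable M. range X \<subseteq> K}"

definition law :: "'a::topological_space set \<Rightarrow> 'w measure \<Rightarrow> ('w \<Rightarrow> 'a) \<Rightarrow> 'a measure" where
  "law K M X = distr M (restrict_space borel K) X"

lemma rvs_measurable:
  "X \<in> rvs M K \<Longrightarrow> X \<in> measurable M (restrict_space borel K)"
  by (auto simp: rvs_def measurable_restrict_space2_iff)

lemma rvs_in: "X \<in> rvs M K \<Longrightarrow> X \<omega> \<in> K"
  by (auto simp: rvs_def)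

lemma law_in_borel_prob_measures:
  assumes "prob_space M" "X \<in> rvs M K"
  shows "law K M X \<in> borel_prob_measures K"
  using assms by (simp add: borel_prob_measures_def law_def prob_space.prob_space_distr rvs_measurable)

lemma integral_law:
  fixes f :: "'a::metric_space \<Rightarrow> real"
  assumes "X \<in> rvs M K" "continuous_on K f"
  shows "(\<integral>x. f x \<partial>law K M X) = (\<integral>\<omega>. f (X \<omega>) \<partial>M)"
  unfolding law_def using assms
  by (intro integral_distr rvs_measurable borel_measurable_continuous_on_restrict)

lemma measure_law_ball:
  assumes "X \<in> rvs M K"
  shows "measure (law K M X) (K \<inter> ball x r) = measure M {\<omega> \<in> space M. X \<omega> \<in> ball x r}"
  unfolding law_def using rvs_in[OF assms]
  by (subst measure_distr[OF rvs_measurable[OF assms]])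
     (auto simp: sets_restrict_space intro!: arg_cong[where f="measure M"])

text \<open>Uniform limits are pointwise limits, which preserve measurability and, \<open>K\<close>
  being closed, values in \<open>K\<close>. Closedness lets \<open>rvs M K\<close> inherit
  completeness from the space of bounded functions.\<close>

lemma closedin_rvs:
  fixes K :: "'a::euclidean_space set" and M :: "'w measure"
  assumes "compact K"
  shows "closedin (Metric_space.mtopology (Met_TC.fspace UNIV) (Met_TC.fdist UNIV)) (rvs M K)"
proof -
  interpret F: Metric_space "Met_TC.fspace UNIV :: ('w \<Rightarrow> 'a) set" "Met_TC.fdist UNIV"
    by (rule Met_TC.Metric_space_funspace)
  show ?thesis
    unfolding F.metric_closedin_iff_sequentially_closed
  proof (intro conjI allI impI)
    show "rvs M K \<subseteq> Met_TC.fspace UNIV"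
      using compact_imp_bounded[OF assms]
      by (auto simp: rvs_def Met_TC.fspace_def intro: bounded_subset)
    fix \<sigma> X assume "range \<sigma> \<subseteq> rvs M K \<and> limitin F.mtopology \<sigma> X sequentially"
    then have \<sigma>: "\<And>n. \<sigma> n \<in> rvs M K" and lim: "limitin F.mtopology \<sigma> X sequentially" by auto
    have conv: "(\<lambda>n. \<sigma> n \<omega>) \<longlonglongrightarrow> X \<omega>" for \<omega>
    proof (rule tendstoI)
      fix e :: real assume "0 < e"
      with lim have X: "X \<in> Met_TC.fspace UNIV" and
        "eventually (\<lambda>n. \<sigma> n \<in> Met_TC.fspace UNIV \<and> Met_TC.fdist UNIV (\<sigma> n) X < e) sequentially"
        by (auto simp: F.limitin_metric)
      from this(2) show "eventually (\<lambda>n. dist (\<sigma> n \<omega>) (X \<omega>) < e) sequentially"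
      proof eventually_elim
        case (elim n)
        then have "dist (\<sigma> n \<omega>) (X \<omega>) \<le> Met_TC.fdist UNIV (\<sigma> n) X"
          using Met_TC.funspace_mdist_le[of "\<sigma> n" UNIV X] X by auto
        with elim show ?case by linarith
      qed
    qed
    have "\<sigma> n \<in> borel_measurable M" for n using \<sigma>[of n] by (simp add: rvs_def)
    then have "X \<in> borel_measurable M" using conv by (rule borel_measurable_LIMSEQ_metric)
    moreover have "X \<omega> \<in> K" for \<omega>
      using compact_imp_closed[OF assms] rvs_in[OF \<sigma>] conv by (rule closed_sequentially)
    ultimately show "X \<in> rvs M K" by (auto simp: rvs_def)
  qed
qed

text \<open>Uniform continuity of \<open>f\<close> on the compact set \<open>K\<close> bounds the
  integrands' difference pointwise. This is the continuity of the law, tested on one function of the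
  weak topology.\<close>

lemma integral_comp_close:
  fixes K :: "'a::euclidean_space set" and f :: "'a \<Rightarrow> real"
  assumes "prob_space M" "compact K" "continuous_on K f" "X \<in> rvs M K" "0 < e"
  obtains d where "0 < d" "\<And>Y. Y \<in> rvs M K \<Longrightarrow> (\<And>\<omega>. dist (X \<omega>) (Y \<omega>) < d) \<Longrightarrow>
    dist (\<integral>\<omega>. f (Y \<omega>) \<partial>M) (\<integral>\<omega>. f (X \<omega>) \<partial>M) \<le> e"
proof -
  interpret prob_space M by fact
  have "uniformly_continuous_on K f"
    using assms by (simp add: compact_uniformly_continuous)
  then obtain d where d: "0 < d" "\<And>x y. x \<in> K \<Longrightarrow> y \<in> K \<Longrightarrow> dist y x < d \<Longrightarrow> dist (f y) (f x) < e"
    unfolding uniformly_continuous_on_def using \<open>0 < e\<close> by metis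
  have "compact (f ` K)" using assms by (simp add: compact_continuous_image)
  then obtain B where B: "\<And>x. x \<in> K \<Longrightarrow> \<bar>f x\<bar> \<le> B"
    using compact_imp_bounded bounded_iff by (metis imageI real_norm_def)
  have int: "integrable M (\<lambda>\<omega>. f (Y \<omega>))" if "Y \<in> rvs M K" for Y
  proof (rule integrable_const_bound[of _ B])
    show "AE \<omega> in M. norm (f (Y \<omega>)) \<le> B" using B rvs_in[OF that] by simp
    show "(\<lambda>\<omega>. f (Y \<omega>)) \<in> borel_measurable M"
      using assms(3) by (intro measurable_compose[OF rvs_measurable[OF that]]
        borel_measurable_continuous_on_restrict)
  qed
  show ?thesis
  proof (rule that[OF d(1)])
    fix Y assume Y: "Y \<in> rvs M K" "\<And>\<omega>. dist (X \<omega>) (Y \<omega>) < d"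
    have "\<bar>\<integral>\<omega>. f (Y \<omega>) - f (X \<omega>) \<partial>M\<bar> \<le> (\<integral>\<omega>. \<bar>f (Y \<omega>) - f (X \<omega>)\<bar> \<partial>M)"
      by (rule integral_abs_bound)
    also have "\<dots> \<le> (\<integral>\<omega>. e \<partial>M)"
    proof (rule integral_mono)
      show "integrable M (\<lambda>\<omega>. \<bar>f (Y \<omega>) - f (X \<omega>)\<bar>)"
        using int[OF Y(1)] int[OF assms(4)] by auto
      show "\<bar>f (Y \<omega>) - f (X \<omega>)\<bar> \<le> e" for \<omega>
        using d(2)[OF rvs_in[OF assms(4)] rvs_in[OF Y(1)]] Y(2)[of \<omega>]
        by (fastforce simp: dist_real_def dist_commute)
    qed simp
    finally show "dist (\<integral>\<omega>. f (Y \<omega>) \<partial>M) (\<integral>\<omega>. f (X \<omega>) \<partial>M) \<le> e"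
      using int[OF Y(1)] int[OF assms(4)] by (simp add: prob_space dist_real_def)
  qed
qed

text \<open>Under the continuous map \<open>law K M\<close>, the sets of the countable family pull
  back to open sets, which are dense by the hypothesis on uniform perturbations. Baire's theorem in
  \<open>rvs M K\<close> makes their intersection dense, so it meets the nonempty open preimage of
  \<open>W\<close>.\<close>

lemma exists_rv_law_generic:
  fixes K :: "'a::euclidean_space set" and M :: "'w measure"
  assumes M: "prob_space M" and K: "compact K" and "countable \<G>"
    and op: "\<And>A. A \<in> \<G> \<Longrightarrow> openin (weak_topology K) A"
    and dense: "\<And>A X e. A \<in> \<G> \<Longrightarrow> X \<in> rvs M K \<Longrightarrow> 0 < e \<Longrightarrow>
      \<exists>Y\<in>rvs M K. (\<forall>\<omega>. dist (X \<omega>) (Y \<omega>) \<le> e) \<and> law K M Y \<in> A"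
    and W: "openin (weak_topology K) W" "X \<in> rvs M K" "law K M X \<in> W"
  obtains Y where "Y \<in> rvs M K" "law K M Y \<in> W" "\<And>A. A \<in> \<G> \<Longrightarrow> law K M Y \<in> A"
proof -
  let ?d = "Met_TC.fdist UNIV :: ('w \<Rightarrow> 'a) \<Rightarrow> _"
  interpret F: Metric_space "Met_TC.fspace UNIV :: ('w \<Rightarrow> 'a) set" ?d
    by (rule Met_TC.Metric_space_funspace)
  have closed: "closedin F.mtopology (rvs M K)" by (rule closedin_rvs[OF K])
  then have sub: "rvs M K \<subseteq> Met_TC.fspace UNIV"
    using F.metric_closedin_iff_sequentially_closed by blast
  interpret S: Submetric "Met_TC.fspace UNIV :: ('w \<Rightarrow> 'a) set" ?d "rvs M K"
    by unfold_locales (rule sub)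
  have "F.mcomplete"
    using Met_TC.mcomplete_funspace[where S="UNIV :: 'w set" and 'a='a]
    by (simp add: mcomplete_of_def Met_TC.Self_def complete_UNIV mcomplete_iff_complete)
  then have complete: "S.sub.mcomplete"
    by (rule S.closedin_mcomplete_imp_mcomplete[OF closed])
  have le: "?d X Y \<le> a \<longleftrightarrow> (\<forall>\<omega>. dist (X \<omega>) (Y \<omega>) \<le> a)"
    if "X \<in> rvs M K" "Y \<in> rvs M K" for X Y a
    using that sub Met_TC.funspace_mdist_le[of X UNIV Y a] by auto
  have cont: "continuous_map S.sub.mtopology (weak_topology K) (law K M)"
    unfolding weak_topology_def
  proof (rule continuous_on_generated_topo)
    show "law K M ` topspace S.sub.mtopology \<subseteq>
      \<Union> {{\<mu> \<in> borel_prob_measures K. (\<integral>x. f x \<partial>\<mu>) \<in> U} | (f :: 'a \<Rightarrow> real) U.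
        continuous_on K f \<and> bounded (f ` K) \<and> open U}"
      unfolding topology_generated_by_topspace[symmetric] weak_topology_def[symmetric]
        topspace_weak_topology
      using law_in_borel_prob_measures[OF M] by auto
    fix A assume "A \<in> {{\<mu> \<in> borel_prob_measures K. (\<integral>x. f x \<partial>\<mu>) \<in> U} | (f :: 'a \<Rightarrow> real) U.
        continuous_on K f \<and> bounded (f ` K) \<and> open U}"
    then obtain f :: "'a \<Rightarrow> real" and U where A: "A = {\<mu> \<in> borel_prob_measures K. (\<integral>x. f x \<partial>\<mu>) \<in> U}"
      and f: "continuous_on K f" and U: "open U" by auto
    show "openin S.sub.mtopology (law K M -` A \<inter> topspace S.sub.mtopology)"
      unfolding S.sub.openin_mtopology
    proof (intro conjI allI impI)
      fix X assume "X \<in> law K M -` A \<inter> topspace S.sub.mtopology"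
      then have X: "X \<in> rvs M K" "(\<integral>\<omega>. f (X \<omega>) \<partial>M) \<in> U"
        using A f by (auto simp: integral_law)
      obtain e where e: "0 < e" "cball (\<integral>\<omega>. f (X \<omega>) \<partial>M) e \<subseteq> U"
        using U X(2) open_contains_cball by blast
      obtain d where d: "0 < d" "\<And>Y. Y \<in> rvs M K \<Longrightarrow> (\<And>\<omega>. dist (X \<omega>) (Y \<omega>) < d) \<Longrightarrow>
          dist (\<integral>\<omega>. f (Y \<omega>) \<partial>M) (\<integral>\<omega>. f (X \<omega>) \<partial>M) \<le> e"
        by (rule integral_comp_close[OF M K f X(1) e(1)]) blast
      have "Y \<in> law K M -` A" if Y: "Y \<in> rvs M K" "?d X Y < d" for Y
      proof -
        have "dist (X \<omega>) (Y \<omega>) < d" for \<omega> using le[OF X(1) Y(1), of "?d X Y"] Y(2)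
          by (meson order.strict_trans1 order_refl)
        then have "(\<integral>\<omega>. f (Y \<omega>) \<partial>M) \<in> U"
          using d(2)[OF Y(1)] e(2) by (auto simp: dist_commute)
        then show ?thesis
          using A Y f law_in_borel_prob_measures[OF M] by (auto simp: integral_law)
      qed
      then show "\<exists>r>0. S.sub.mball X r \<subseteq> law K M -` A \<inter> topspace S.sub.mtopology"
        using d(1) by (intro exI[of _ d]) auto
    qed auto
  qed
  let ?pre = "\<lambda>A. {X \<in> topspace S.sub.mtopology. law K M X \<in> A}"
  have "S.sub.mtopology closure_of \<Inter>(?pre ` \<G>) = rvs M K"
  proof (rule S.sub.metric_Baire_category[OF complete])
    show "countable (?pre ` \<G>)" using \<open>countable \<G>\<close> by simp
    fix T assume "T \<in> ?pre ` \<G>"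
    then obtain A where A: "A \<in> \<G>" "T = ?pre A" by blast
    have "openin S.sub.mtopology T"
      unfolding A(2) using cont op[OF A(1)] by (rule openin_continuous_map_preimage)
    moreover have "S.sub.mtopology closure_of T = rvs M K"
    proof (intro subset_antisym subsetI)
      fix X assume "X \<in> S.sub.mtopology closure_of T"
      then show "X \<in> rvs M K" by (auto simp: S.sub.metric_closure_of)
    next
      fix X assume X: "X \<in> rvs M K"
      have "\<exists>Y\<in>T. Y \<in> S.sub.mball X r" if "0 < r" for r
      proof -
        \<comment> \<open>Pointwise bounds control the supremum only non-strictly;
          \<open>r / 2\<close> restores the strict bound.\<close>
        obtain Y where Y: "Y \<in> rvs M K" "\<forall>\<omega>. dist (X \<omega>) (Y \<omega>) \<le> r / 2" "law K M Y \<in> A"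
          using dense[OF A(1) X half_gt_zero[OF \<open>0 < r\<close>]] by blast
        then have "?d X Y < r" using le[OF X Y(1), of "r / 2"] that by simp
        then show ?thesis using X Y A by auto
      qed
      then show "X \<in> S.sub.mtopology closure_of T" using X by (auto simp: S.sub.metric_closure_of)
    qed
    ultimately show "openin S.sub.mtopology T \<and> S.sub.mtopology closure_of T = rvs M K" ..
  qed
  moreover have "openin S.sub.mtopology (?pre W)"
    using cont W(1) by (rule openin_continuous_map_preimage)
  moreover have "X \<in> ?pre W" using W by simp
  ultimately have "\<Inter>(?pre ` \<G>) \<inter> ?pre W \<noteq> {}"
    using dense_intersects_open[of S.sub.mtopology "\<Inter>(?pre ` \<G>)"] by auto
  then obtain Y where "Y \<in> \<Inter>(?pre ` \<G>)" "Y \<in> ?pre W" by blast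
  then show ?thesis by (intro that[of Y]) auto
qed

section \<open>Perturbing a random variable into the open sets\<close>

lemma finite_separation:
  fixes C :: "'a::metric_space set"
  assumes "finite C"
  obtains d where "0 < d" "\<And>c c'. c \<in> C \<Longrightarrow> c' \<in> C \<Longrightarrow> c \<noteq> c' \<Longrightarrow> d \<le> dist c c'"
proof -
  \<comment> \<open>The extra 1 keeps the set nonempty when \<open>C\<close> has at most one
    point.\<close>
  let ?D = "insert 1 ((\<lambda>(c, c'). dist c c') ` (C \<times> C - Id))"
  have fin: "finite ?D" using assms by simp
  show ?thesis
  proof (rule that[of "Min ?D"])
    show "0 < Min ?D" using fin by (subst Min_gr_iff) auto
    show "Min ?D \<le> dist c c'" if "c \<in> C" "c' \<in> C" "c \<noteq> c'" for c c'
      using that by (intro Min_le[OF fin]) force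
  qed
qed

text \<open>Each value of \<open>X\<close> is replaced by the first close enough centre of a finite
  cover. The index \<open>J\<close> is returned rather than the centre, so that later constructions
  can be split over countably many cases.\<close>

lemma finite_valued_approximation:
  fixes K :: "'a::euclidean_space set"
  assumes "compact K" "X \<in> rvs M K" "0 < e"
  obtains f :: "nat \<Rightarrow> 'a" and m :: nat and J where
    "f ` {..<m} \<subseteq> K" "J \<in> measurable M (count_space UNIV)"
    "\<And>\<omega>. J \<omega> < m \<and> dist (X \<omega>) (f (J \<omega>)) < e"
proof -
  have "K \<subseteq> (\<Union>x\<in>K. ball x e)" using \<open>0 < e\<close> by auto
  then obtain C where C: "C \<subseteq> K" "finite C" "K \<subseteq> (\<Union>x\<in>C. ball x e)"
    by (rule compactE_image[OF assms(1) open_ball]) blast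
  obtain f :: "nat \<Rightarrow> 'a" and m where f: "C = f ` {i. i < m}"
    using finite_imp_nat_seg_image_inj_on[OF C(2)] by blast
  have [measurable]: "X \<in> borel_measurable M" using assms by (simp add: rvs_def)
  define J where "J \<omega> = (LEAST i. i < m \<and> dist (X \<omega>) (f i) < e)" for \<omega>
  show ?thesis
  proof (rule that[of f m J])
    show "f ` {..<m} \<subseteq> K" using C f by auto
    show "J \<in> measurable M (count_space UNIV)" unfolding J_def by measurable
    fix \<omega>
    obtain c where "c \<in> C" "X \<omega> \<in> ball c e" using C rvs_in[OF assms(2), of \<omega>] by blast
    then have "\<exists>i. i < m \<and> dist (X \<omega>) (f i) < e" using f by (auto simp: dist_commute)
    then show "J \<omega> < m \<and> dist (X \<omega>) (f (J \<omega>)) < e" unfolding J_def by (rule LeastI_ex)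
  qed
qed

text \<open>The slack between the exponents absorbs a constant factor at small scales. The factor 6
  is 2 times 3: a ball of radius R/2 contains at most one point of an R-separated set, and
  \<open>small_ballsI\<close> needs a ball of three times the final radius.\<close>

lemma powr_gap:
  fixes s s' \<eta> :: real
  assumes "s < s'" "0 < \<eta>"
  obtains e where "0 < e" "e \<le> \<eta>" "\<And>R. 0 < R \<Longrightarrow> R < e \<Longrightarrow> R powr s' \<le> (R / 6) powr s"
proof -
  \<comment> \<open>The second term solves \<open>e powr (s' - s) = 6 powr - s\<close>.\<close>
  define e where "e = min \<eta> ((6 powr - s) powr (1 / (s' - s)))"
  show ?thesis
  proof (rule that[of e])
    show "0 < e" "e \<le> \<eta>" using assms by (auto simp: e_def)
    fix R assume R: "0 < R" "R < e"
    have "R powr (s' - s) \<le> ((6 powr - s) powr (1 / (s' - s))) powr (s' - s)"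
      using R assms by (intro powr_mono2) (auto simp: e_def)
    also have "\<dots> = 6 powr - s" using assms by (simp add: powr_powr)
    finally have "R powr s * R powr (s' - s) \<le> R powr s * 6 powr - s"
      by (intro mult_left_mono) auto
    moreover have "R powr s * R powr (s' - s) = R powr s'" by (simp flip: powr_add)
    moreover have "R powr s * 6 powr - s = (R / 6) powr s"
      using R by (simp add: powr_divide powr_minus field_simps)
    ultimately show "R powr s' \<le> (R / 6) powr s" by simp
  qed
qed

text \<open>The functions \<open>g N\<close> need not be independent of \<open>X\<close>: once \<open>X\<close> has been replaced by a
  finite-valued variable, each of its values \<open>c\<close> is spread, with the help of \<open>g N\<close>, over \<open>N\<close>
  points near \<open>c\<close> that are \<open>R\<close>-separated, where \<open>N > R powr - s'\<close>. No new point then has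
  probability above \<open>1 / N\<close>. The scale \<open>R\<close> depends on \<open>c\<close>, which is harmless because the
  clusters are far apart and points away from all clusters see no mass at small scales.\<close>

lemma dense_small_balls:
  fixes K :: "'a::euclidean_space set"
  assumes M: "prob_space M" and K: "compact K" and s: "ereal s < local_upper_box_dim K"
    and g_meas: "\<And>N. 0 < N \<Longrightarrow> g N \<in> measurable M (count_space UNIV)"
    and g_less: "\<And>N \<omega>. 0 < N \<Longrightarrow> \<omega> \<in> space M \<Longrightarrow> g N \<omega> < N"
    and g_prob: "\<And>N k. 0 < N \<Longrightarrow> measure M {\<omega> \<in> space M. g N \<omega> = (k::nat)} \<le> 1 / real N"
    and X: "X \<in> rvs M K" and "0 < e"
  shows "\<exists>Y\<in>rvs M K. (\<forall>\<omega>. dist (X \<omega>) (Y \<omega>) \<le> e) \<and> law K M Y \<in> small_balls K s n"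
proof -
  interpret prob_space M by fact
  obtain s' where s': "s < s'" "ereal s' < local_upper_box_dim K"
    using ereal_dense2[OF s] by auto
  obtain f :: "nat \<Rightarrow> 'a" and m :: nat and J where f: "f ` {..<m} \<subseteq> K"
    and J: "J \<in> measurable M (count_space UNIV)"
    and close: "\<And>\<omega>. J \<omega> < m \<and> dist (X \<omega>) (f (J \<omega>)) < e / 2"
    by (rule finite_valued_approximation[OF K X half_gt_zero[OF \<open>0 < e\<close>]]) blast
  define C where "C = f ` {..<m}"
  have C: "finite C" "C \<subseteq> K" using f by (auto simp: C_def)
  obtain d0 where d0: "0 < d0" "\<And>c c'. c \<in> C \<Longrightarrow> c' \<in> C \<Longrightarrow> c \<noteq> c' \<Longrightarrow> d0 \<le> dist c c'"
    using finite_separation[OF C(1)] by blast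
  \<comment> \<open>The first bound leaves half of \<open>e\<close> for spreading. The second
    separates clusters: a point within 2\<delta> of \<open>c\<close> and within R/2 < \<delta>/2 of
    a cluster around c' would give \<open>dist c c'\<close> < 4\<delta>.\<close>
  define \<delta> where "\<delta> = min (e / 2) (d0 / 4)"
  have \<delta>: "0 < \<delta>" "\<delta> \<le> e / 2" "4 * \<delta> \<le> d0" using d0(1) \<open>0 < e\<close> by (auto simp: \<delta>_def)
  obtain \<eta> where \<eta>: "0 < \<eta>" "\<eta> \<le> min \<delta> (6 / (real n + 1))"
    "\<And>R. 0 < R \<Longrightarrow> R < \<eta> \<Longrightarrow> R powr s' \<le> (R / 6) powr s"
  proof (rule powr_gap[OF s'(1), of "min \<delta> (6 / (real n + 1))"])
    show "0 < min \<delta> (6 / (real n + 1))" using \<delta>(1) by simp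
  qed (use that in blast)
  have "\<exists>R S. 0 < R \<and> R < \<eta> \<and> finite S \<and> S \<subseteq> K \<inter> ball c \<delta> \<and>
      pairwise (\<lambda>x y. R \<le> dist x y) S \<and> R powr - s' < real (card S)" if "c \<in> C" for c
  proof -
    have "local_upper_box_dim K \<le> upper_box_dim (K \<inter> ball c \<delta>)"
      unfolding local_upper_box_dim_def using that C \<delta> by (intro INF_lower2[of c] INF_lower) auto
    with s' have "ereal s' < upper_box_dim (K \<inter> ball c \<delta>)" by simp
    then show ?thesis using \<eta>(1) by (rule upper_box_dim_gt_separated) blast
  qed
  then obtain R S where RS: "\<And>c. c \<in> C \<Longrightarrow> 0 < R c \<and> R c < \<eta> \<and> finite (S c) \<and>
      S c \<subseteq> K \<inter> ball c \<delta> \<and> pairwise (\<lambda>x y. R c \<le> dist x y) (S c) \<and>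
      R c powr - s' < real (card (S c))"
    by metis
  define N where "N c = card (S c)" for c
  have N: "0 < N c" "1 / real (N c) < R c powr s'" if "c \<in> C" for c
  proof -
    have *: "0 < R c powr - s'" "R c powr - s' < real (N c)" using RS[OF that] by (auto simp: N_def)
    then have "0 < real (N c)" by linarith
    then show "0 < N c" by simp
    have "inverse (real (N c)) < inverse (R c powr - s')" using * by (intro less_imp_inverse_less)
    then show "1 / real (N c) < R c powr s'" by (simp add: powr_minus inverse_eq_divide)
  qed
  have "\<exists>h. bij_betw h {..<N c} (S c)" if "c \<in> C" for c
    using RS[OF that] ex_bij_betw_nat_finite[of "S c"] by (auto simp: N_def atLeast0LessThan)
  then obtain h where h: "\<And>c. c \<in> C \<Longrightarrow> bij_betw (h c) {..<N c} (S c)" by metis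
  \<comment> \<open>Off \<open>space M\<close> the value of \<open>g N\<close> may be out of range;
    index 0 then keeps \<open>Y\<close> inside the cluster.\<close>
  define \<sigma> where "\<sigma> c k = h c (if k < N c then k else 0)" for c k
  have \<sigma>: "\<sigma> c k \<in> S c" if "c \<in> C" for c k
    using bij_betw_apply[OF h[OF that]] N(1)[OF that] by (auto simp: \<sigma>_def)
  have JC: "f (J \<omega>) \<in> C" for \<omega> using close by (auto simp: C_def)
  define Y where "Y \<omega> = \<sigma> (f (J \<omega>)) (g (N (f (J \<omega>))) \<omega>)" for \<omega>
  have YS: "Y \<omega> \<in> S (f (J \<omega>))" for \<omega> unfolding Y_def by (rule \<sigma>[OF JC])
  then have YK: "Y \<omega> \<in> K" and Y\<delta>: "dist (f (J \<omega>)) (Y \<omega>) < \<delta>" for \<omega>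
    using RS[OF JC[of \<omega>]] by (auto simp: subset_iff)
  \<comment> \<open>Composition over a countable index requires measurability for every natural
    \<open>i\<close>, but \<open>f i\<close> is known to lie in \<open>C\<close> only for i < m.
    Clamping the index repairs this and does not change \<open>J\<close>.\<close>
  have "(\<lambda>\<omega>. \<sigma> (f (min i (m - 1))) (g (N (f (min i (m - 1)))) \<omega>)) \<in> borel_measurable M" for i
  proof -
    have "0 < m" using close by (metis gr_implies_not0 not_gr0)
    then have "f (min i (m - 1)) \<in> C" by (auto simp: C_def)
    from g_meas[OF N(1)[OF this]] show ?thesis by (rule measurable_compose) simp
  qed
  then have "(\<lambda>\<omega>. \<sigma> (f (min (J \<omega>) (m - 1))) (g (N (f (min (J \<omega>) (m - 1)))) \<omega>))
      \<in> borel_measurable M"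
    using J by (rule measurable_compose_countable)
  moreover have "min (J \<omega>) (m - 1) = J \<omega>" for \<omega> using close[of \<omega>] by linarith
  ultimately have "Y \<in> borel_measurable M" by (simp add: Y_def[abs_def])
  then have Y: "Y \<in> rvs M K" using YK by (auto simp: rvs_def)
  have dist: "dist (X \<omega>) (Y \<omega>) \<le> e" for \<omega>
    using close[of \<omega>] Y\<delta>[of \<omega>] \<delta>(2) dist_triangle[of "X \<omega>" "Y \<omega>" "f (J \<omega>)"] by linarith
  have "\<exists>r. 0 < r \<and> r < 1 / (real n + 1) \<and> prob {\<omega> \<in> space M. Y \<omega> \<in> ball x (3 * r)} < r powr s"
    if "x \<in> K" for x
  proof (cases "\<exists>c\<in>C. dist x c < 2 * \<delta>")
    case True
    then obtain c where c: "c \<in> C" "dist x c < 2 * \<delta>" by blast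
    have R: "0 < R c" "R c < \<eta>" "R c < \<delta>" "R c < 6 / (real n + 1)"
      using RS[OF c(1)] \<eta>(2) by auto
    let ?A = "{\<omega> \<in> space M. Y \<omega> \<in> ball x (R c / 2)}"
    have Jc: "f (J \<omega>) = c" if "\<omega> \<in> ?A" for \<omega>
    proof (rule ccontr)
      assume "f (J \<omega>) \<noteq> c"
      then have "d0 \<le> dist c (f (J \<omega>))" using d0(2)[OF c(1) JC] by metis
      moreover have "dist x (Y \<omega>) < R c / 2" using that by simp
      ultimately show False
        using dist_triangle[of c "f (J \<omega>)" x] dist_triangle[of x "f (J \<omega>)" "Y \<omega>"]
          Y\<delta>[of \<omega>] c(2) \<delta>(3) R dist_commute[of c x] dist_commute[of "f (J \<omega>)" "Y \<omega>"] by linarith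
    qed
    have Yh: "Y \<omega> = h c (g (N c) \<omega>) \<and> g (N c) \<omega> < N c" if "\<omega> \<in> ?A" for \<omega>
      using Jc[OF that] g_less[OF N(1)[OF c(1)], of \<omega>] that by (simp add: Y_def \<sigma>_def)
    \<comment> \<open>On \<open>?A\<close> all values of \<open>Y\<close> lie in the one cluster
      \<open>S c\<close> and are less than \<open>R c\<close> apart, hence equal. Injectivity of
      \<open>h c\<close> then fixes the value of \<open>g (N c)\<close>.\<close>
    have "\<exists>k. ?A \<subseteq> {\<omega> \<in> space M. g (N c) \<omega> = k}"
    proof (cases "?A = {}")
      case False
      then obtain \<omega>0 where \<omega>0: "\<omega>0 \<in> ?A" by blast
      have "g (N c) \<omega> = g (N c) \<omega>0" if \<omega>: "\<omega> \<in> ?A" for \<omega>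
      proof -
        have "dist x (Y \<omega>) < R c / 2" "dist x (Y \<omega>0) < R c / 2" using \<omega> \<omega>0 by auto
        then have "dist (Y \<omega>) (Y \<omega>0) < R c"
          using dist_triangle[of "Y \<omega>" "Y \<omega>0" x] dist_commute[of x "Y \<omega>"] by linarith
        moreover have "Y \<omega> \<in> S c" "Y \<omega>0 \<in> S c" using YS Jc[OF \<omega>] Jc[OF \<omega>0] by metis+
        ultimately have "Y \<omega> = Y \<omega>0"
          using RS[OF c(1)] by (meson not_le pairwiseD)
        then show ?thesis
          using Yh[OF \<omega>] Yh[OF \<omega>0] h[OF c(1)] by (auto simp: bij_betw_def dest: inj_onD)
      qed
      then show ?thesis by (intro exI[of _ "g (N c) \<omega>0"]) blast
    qed auto
    then obtain k where k: "?A \<subseteq> {\<omega> \<in> space M. g (N c) \<omega> = k}" by blast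
    have "{\<omega> \<in> space M. g (N c) \<omega> = k} = g (N c) -` {k} \<inter> space M" by auto
    then have "{\<omega> \<in> space M. g (N c) \<omega> = k} \<in> sets M"
      using g_meas[OF N(1)[OF c(1)]] by (simp add: measurable_sets)
    with k have "prob ?A \<le> prob {\<omega> \<in> space M. g (N c) \<omega> = k}"
      by (rule finite_measure_mono)
    also have "\<dots> \<le> 1 / real (N c)" by (rule g_prob[OF N(1)[OF c(1)]])
    also have "\<dots> < R c powr s'" by (rule N(2)[OF c(1)])
    also have "\<dots> \<le> (R c / 6) powr s" using R by (intro \<eta>(3))
    finally show ?thesis using R by (intro exI[of _ "R c / 6"]) (simp add: field_simps)
  next
    case False
    \<comment> \<open>Here \<open>x\<close> is at least 2\<delta> from all centres and
      \<open>Y\<close> is within \<delta> of one, so a ball of radius 3r \<le> \<delta> around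
      \<open>x\<close> is never hit. The 2 in the second term makes the bound on \<open>r\<close>
      strict.\<close>
    define r where "r = min (\<delta> / 3) (1 / (2 * (real n + 1)))"
    have r: "0 < r" "3 * r \<le> \<delta>" using \<delta>(1) by (auto simp: r_def)
    have "r \<le> 1 / (2 * (real n + 1))" by (simp add: r_def)
    also have "\<dots> < 1 / (real n + 1)" by (simp add: field_simps)
    finally have "r < 1 / (real n + 1)" .
    have "dist x (Y \<omega>) \<ge> 3 * r" for \<omega>
    proof -
      have "2 * \<delta> \<le> dist x (f (J \<omega>))" using False JC by (meson not_le)
      then show ?thesis
        using dist_triangle[of x "f (J \<omega>)" "Y \<omega>"] Y\<delta>[of \<omega>] dist_commute[of "f (J \<omega>)" "Y \<omega>"] r(2)
        by linarith
    qed
    then have "{\<omega> \<in> space M. Y \<omega> \<in> ball x (3 * r)} = {}" by (auto simp: not_less)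
    then have "prob {\<omega> \<in> space M. Y \<omega> \<in> ball x (3 * r)} = 0" by (simp only: measure_empty)
    then show ?thesis using r(1) \<open>r < 1 / (real n + 1)\<close> by (intro exI[of _ r]) (simp del: mem_ball)
  qed
  then have "law K M Y \<in> small_balls K s n"
    by (intro small_ballsI K law_in_borel_prob_measures M Y) (simp add: measure_law_ball[OF Y])
  with Y dist show ?thesis by blast
qed

section \<open>The auxiliary probability space\<close>

text \<open>The index is shifted: coordinate \<open>N\<close> is uniform on \<open>N + 1\<close> values.\<close>

abbreviation uniform_sequence :: "(nat \<Rightarrow> nat) measure" where
  "uniform_sequence \<equiv> Pi\<^sub>M UNIV (\<lambda>N. uniform_count_measure {..N})"

lemma prob_space_uniform_atMost: "prob_space (uniform_count_measure {..N::nat})"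
  by (rule prob_space_uniform_count_measure) auto

lemma measure_uniform_sequence:
  "measure uniform_sequence {w \<in> space uniform_sequence. w N = k} \<le> 1 / real (Suc N)"
proof -
  interpret product_prob_space "\<lambda>N. uniform_count_measure {..N::nat}" UNIV
    by (intro product_prob_spaceI prob_space_uniform_atMost)
  have "{w \<in> space uniform_sequence. w N = k} = (\<lambda>w. w N) -` ({k} \<inter> {..N}) \<inter> space uniform_sequence"
    by (auto simp: space_PiM PiE_iff space_uniform_count_measure)
  then have "measure uniform_sequence {w \<in> space uniform_sequence. w N = k} =
      measure (distr uniform_sequence (uniform_count_measure {..N}) (\<lambda>w. w N)) ({k} \<inter> {..N})"
    by (subst measure_distr) (auto simp: sets_uniform_count_measure)
  also have "\<dots> = measure (uniform_count_measure {..N}) ({k} \<inter> {..N})"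
    by (subst PiM_component) auto
  also have "\<dots> = real (card ({k} \<inter> {..N})) / real (Suc N)"
    by (subst measure_uniform_count_measure) auto
  also have "\<dots> \<le> 1 / real (Suc N)"
    using card_mono[of "{k}" "{k} \<inter> {..N}"] by (intro divide_right_mono) auto
  finally show ?thesis .
qed

text \<open>The space has to be fixed before Baire's theorem is applied, when the cluster sizes are
  still unknown. It therefore carries a uniform variable on N values for every positive
  \<open>N\<close> at once.\<close>

lemma rich_extension:
  fixes K :: "'a::euclidean_space set"
  assumes \<mu>: "\<mu> \<in> borel_prob_measures K"
  obtains M :: "('a \<times> (nat \<Rightarrow> nat)) measure" and X g where
    "prob_space M" "X \<in> rvs M K" "law K M X = \<mu>"
    "\<And>N. 0 < N \<Longrightarrow> g N \<in> measurable M (count_space UNIV)"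
    "\<And>N \<omega>. 0 < N \<Longrightarrow> \<omega> \<in> space M \<Longrightarrow> g N \<omega> < N"
    "\<And>N k. 0 < N \<Longrightarrow> measure M {\<omega> \<in> space M. g N \<omega> = (k::nat)} \<le> 1 / real N"
proof -
  interpret \<mu>: prob_space \<mu> using borel_prob_measuresD[OF \<mu>] by simp
  interpret S: prob_space uniform_sequence
    by (intro prob_space_PiM prob_space_uniform_atMost)
  define M where "M = \<mu> \<Otimes>\<^sub>M uniform_sequence"
  interpret P: pair_prob_space \<mu> uniform_sequence ..
  have spM: "space M = K \<times> space uniform_sequence"
    by (simp add: M_def space_pair_measure borel_prob_measuresD[OF \<mu>])
  obtain k0 where k0: "k0 \<in> K" using \<mu>.not_empty borel_prob_measuresD[OF \<mu>] by auto
  \<comment> \<open>The default \<open>k0\<close> gives values in \<open>K\<close> on the whole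
    type, as \<open>rvs\<close> demands; on \<open>space M\<close> this is just
    \<open>fst\<close>.\<close>
  define X where "X \<omega> = (if fst \<omega> \<in> K then fst \<omega> else k0)" for \<omega> :: "'a \<times> (nat \<Rightarrow> nat)"
  define g where "g N \<omega> = snd \<omega> (N - 1)" for N :: nat and \<omega> :: "'a \<times> (nat \<Rightarrow> nat)"
  have fst: "fst \<in> measurable M (restrict_space borel K)"
    unfolding M_def using measurable_cong_sets[OF refl borel_prob_measuresD(3)[OF \<mu>]] measurable_fst
    by blast
  have Xfst: "X \<omega> = fst \<omega>" if "\<omega> \<in> space M" for \<omega> using that by (auto simp: X_def spM)
  have "X \<in> measurable M (restrict_space borel K)"
    using fst Xfst by (simp cong: measurable_cong)
  then have X: "X \<in> rvs M K"
    using k0 by (auto simp: rvs_def X_def measurable_restrict_space2_iff)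
  have "law K M X = distr M \<mu> fst"
    unfolding law_def using Xfst by (intro distr_cong borel_prob_measuresD(3)[OF \<mu>, symmetric]) auto
  also have "\<dots> = \<mu>"
    unfolding M_def by (rule S.distr_pair_fst)
  finally have law: "law K M X = \<mu>" .
  have comp: "(\<lambda>w. w N) \<in> measurable uniform_sequence (count_space UNIV)" for N
  proof -
    have "(\<lambda>w. w N) \<in> measurable uniform_sequence (uniform_count_measure {..N})" by simp
    then have "(\<lambda>w. w N) \<in> measurable uniform_sequence (count_space {..N})"
      using measurable_cong_sets[OF refl sets_uniform_count_measure_count_space] by blast
    from measurable_compose[OF this, of "\<lambda>x. x" "count_space UNIV"] show ?thesis by simp
  qed
  have gm: "g N \<in> measurable M (count_space UNIV)" for N
    unfolding g_def M_def using comp by (intro measurable_compose[OF measurable_snd])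
  have gl: "g N \<omega> < N" if "0 < N" "\<omega> \<in> space M" for N \<omega>
  proof -
    have "snd \<omega> (N - 1) \<in> {..N - 1}"
      using that(2) by (auto simp: spM space_PiM PiE_iff space_uniform_count_measure)
    then show ?thesis using that(1) by (simp add: g_def)
  qed
  have gp: "measure M {\<omega> \<in> space M. g N \<omega> = k} \<le> 1 / real N" if "0 < N" for N k
  proof -
    let ?B = "{w \<in> space uniform_sequence. w (N - 1) = k}"
    have "?B = (\<lambda>w. w (N - 1)) -` {k} \<inter> space uniform_sequence" by auto
    then have B: "?B \<in> sets uniform_sequence" using measurable_sets[OF comp] by simp
    have "{\<omega> \<in> space M. g N \<omega> = k} = space \<mu> \<times> ?B"
      by (auto simp: spM g_def borel_prob_measuresD[OF \<mu>])
    then have "measure M {\<omega> \<in> space M. g N \<omega> = k} = measure uniform_sequence ?B"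
      using S.emeasure_pair_measure_Times[OF sets.top B, of \<mu>]
      by (simp add: M_def measure_def \<mu>.emeasure_space_1)
    also have "\<dots> \<le> 1 / real N"
      using measure_uniform_sequence[of "N - 1" k] that by simp
    finally show ?thesis .
  qed
  show ?thesis
    using P.prob_space_axioms by (intro that[of M X g] X law gm gl gp) (auto simp: M_def)
qed

theorem theorem1p2:
  fixes K :: "'a::euclidean_space set"
  assumes "compact K"
  shows "typical (weak_topology K)
           (\<lambda>\<mu>. \<forall>x\<in>K. upper_local_dim \<mu> x \<ge> local_upper_box_dim K)"
proof -
  \<comment> \<open>Rational exponents keep the family countable. Inserting the whole space in the
    next line makes the intersected family visibly nonempty and its intersection visibly a set of
    probability measures.\<close>
  let ?\<G> = "{small_balls K (of_rat q) n | q n. ereal (of_rat q) < local_upper_box_dim K}"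
  let ?G = "\<Inter>(insert (borel_prob_measures K) ?\<G>)"
  have "?\<G> \<subseteq> (\<lambda>(q, n). small_balls K (of_rat q) n) ` UNIV" by auto
  then have cnt: "countable ?\<G>" by (rule countable_subset) (rule countable_image, simp)
  have "openin (weak_topology K) (borel_prob_measures K)"
    unfolding topspace_weak_topology[symmetric] by (rule openin_topspace)
  then have "gdelta_in (weak_topology K) ?G"
    using cnt by (intro gdelta_in_Inter) (auto intro: open_imp_gdelta_in openin_small_balls)
  moreover have "weak_topology K closure_of ?G = topspace (weak_topology K)"
    unfolding dense_intersects_open
  proof (intro allI impI)
    fix W assume W: "openin (weak_topology K) W \<and> W \<noteq> {}"
    then obtain \<mu> where "\<mu> \<in> W" by blast
    then have "\<mu> \<in> borel_prob_measures K"
      using W openin_subset topspace_weak_topology by blast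
    \<comment> \<open>A measure in \<open>W\<close> becomes the law of \<open>X\<close>, so that
      \<open>W\<close> has a nonempty preimage among the random variables.\<close>
    then obtain M :: "('a \<times> (nat \<Rightarrow> nat)) measure" and X g where M: "prob_space M"
      and X: "X \<in> rvs M K" "law K M X = \<mu>"
      and g: "\<And>N. 0 < N \<Longrightarrow> g N \<in> measurable M (count_space UNIV)"
        "\<And>N \<omega>. 0 < N \<Longrightarrow> \<omega> \<in> space M \<Longrightarrow> g N \<omega> < N"
        "\<And>N k. 0 < N \<Longrightarrow> measure M {\<omega> \<in> space M. g N \<omega> = (k::nat)} \<le> 1 / real N"
      by (rule rich_extension) blast
    obtain Y where Y: "Y \<in> rvs M K" "law K M Y \<in> W" "\<And>A. A \<in> ?\<G> \<Longrightarrow> law K M Y \<in> A"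
    proof (rule exists_rv_law_generic[OF M assms cnt])
      show "openin (weak_topology K) A" if "A \<in> ?\<G>" for A
        using that by (auto intro: openin_small_balls)
      show "\<exists>Y\<in>rvs M K. (\<forall>\<omega>. dist (X \<omega>) (Y \<omega>) \<le> e) \<and> law K M Y \<in> A"
        if "A \<in> ?\<G>" "X \<in> rvs M K" "0 < e" for A X e
      proof -
        from that(1) obtain q n where "A = small_balls K (of_rat q) n"
          "ereal (of_rat q) < local_upper_box_dim K" by blast
        with dense_small_balls[OF M assms _ g that(2,3)] show ?thesis by blast
      qed
      show "openin (weak_topology K) W" "X \<in> rvs M K" "law K M X \<in> W"
        using W X \<open>\<mu> \<in> W\<close> by auto
    qed blast
    then have "law K M Y \<in> ?G" using law_in_borel_prob_measures[OF M] by blast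
    with Y(2) show "?G \<inter> W \<noteq> {}" by blast
  qed
  moreover have "local_upper_box_dim K \<le> upper_local_dim \<mu> x" if \<mu>: "\<mu> \<in> ?G" and "x \<in> K" for \<mu> x
  proof (rule ccontr)
    assume "\<not> local_upper_box_dim K \<le> upper_local_dim \<mu> x"
    then obtain q where q: "upper_local_dim \<mu> x < ereal (of_rat q)"
      "ereal (of_rat q) < local_upper_box_dim K"
      using ereal_dense3 by (auto simp: not_le)
    then have "\<mu> \<in> small_balls K (of_rat q) n" for n using \<mu> by blast
    then have "ereal (of_rat q) \<le> upper_local_dim \<mu> x"
      using \<open>x \<in> K\<close> by (intro upper_local_dim_ge small_ballsD) auto
    with q(1) show False by simp
  qed
  ultimately show ?thesis unfolding typical_def by blast
qed

end
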